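(* Let $\mathcal{S}=(V,\Sigma,\delta)$ be a finite nondeterministic fuzzy transition system, $u,v\in V$, $k\in\mathbb{N}$ and $\alpha\in[0,1]$. Let $H_k^\alpha(u,v)$ be the $(k+1)$-vector of relations on $V$ defined by $H_k^\alpha(u,v)[k+1]=D_u[k]\times D_v[k]$ and, for $1\le i\le k$, $H_k^\alpha(u,v)[i]$ is the set of all $(x,y)\in D_u[i-1]\times D_v[i-1]$ such that for every $\tau\in\Sigma$: $x\overset{\tau}{\longrightarrow}p$ implies there is $y\overset{\tau}{\longrightarrow}q$ with $(p,q)\in(H_k^\alpha(u,v)[i+1])_\alpha^\dagger$, and $y\overset{\tau}{\longrightarrow}q$ implies there is $x\overset{\tau}{\longrightarrow}p$ with $(p,q)\in(H_k^\alpha(u,v)[i+1])_\alpha^\dagger$. Then $H_k^\alpha(u,v)$ is a $k$-limited $\alpha$-bisimulation vector contained (componentwise) in $B_k(u,v)=(D_u[0]\times D_v[0],D_u[1]\times D_v[1],\ldots,D_u[k]\times D_v[k])$, and further $u\approx_k^\alpha v$ if and only if $H_k^\alpha(u,v)[1]=\{(u,v)\}$.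
   Context: Let $\otimes$ be a fixed left-continuous $t$-norm on $[0,1]$: commutative, associative, increasing, with neutral element $1$, and $r\otimes\bigvee_i r_i=\bigvee_i (r\otimes r_i)$. Its residuum is $t\rightarrow r=\bigvee\{s\in[0,1]: s\otimes t\le r\}$. $\wedge,\vee$ (and $\bigwedge,\bigvee$) are min, max (inf, sup) in $[0,1]$; $\mathbb{N}$ contains $0$. $V$ is a nonempty finite set; $\mathcal{R}(V)$ is the set of fuzzy subsets of $V$ (maps $V\to[0,1]$), also called distributions. For $p\in\mathcal{R}(V)$ and $X\subseteq V$, $p(X)=\bigvee_{x\in X}p(x)$ (with $p(\emptyset)=0$). A nondeterministic fuzzy transition system (NFTS) is a triple $\mathcal{S}=(V,\Sigma,\delta)$ with $\Sigma$ a set of labels and $\delta\subseteq V\times\Sigma\times\mathcal{R}(V)$; $\delta(u,\tau)=\{p:(u,\tau,p)\in\delta\}$, and $u\overset{\tau}{\longrightarrow}p$ means $p\in\delta(u,\tau)$. It is finite if $V$ and $\Sigma$ are finite and every $\delta(u,\tau)$ is finite. For $R\subseteq V\times V$: $\overrightarrow{R}_u=\{v:(u,v)\in R\}$, $\overleftarrow{R}_u=\{v:(v,u)\in R\}$, and $\widetilde{S}(p,q,R)=\bigwedge_{u\in V}\big((p(u)\rightarrow q(\overrightarrow{R}_u))\wedge(q(u)\rightarrow p(\overleftarrow{R}_u))\big)$. The lifted relation is $R_\alpha^{\dagger}=\{(p,q)\in\mathcal{R}(V)\times\mathcal{R}(V):\widetilde{S}(p,q,R)\ge\alpha\}$. $k$-limited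 $\alpha$-bisimilarity $\approx_k^{\alpha}\subseteq V\times V$: $u\approx_0^\alpha v$ for all $u,v$; and $u\approx_{i+1}^\alpha v$ iff for each $\tau\in\Sigma$: $u\overset{\tau}{\longrightarrow}p$ implies there is $v\overset{\tau}{\longrightarrow}q$ with $(p,q)\in(\approx_i^\alpha)_\alpha^\dagger$; and $v\overset{\tau}{\longrightarrow}q$ implies there is $u\overset{\tau}{\longrightarrow}p$ with $(p,q)\in(\approx_i^\alpha)_\alpha^\dagger$. $D_u[0]=\{u\}$ and $D_u[i+1]=\{y\in V:\exists x\in D_u[i],\tau\in\Sigma,p\in\delta(x,\tau)\text{ with }p(y)>0\}$. A $(k+1)$-vector $B=(B[1],\ldots,B[k+1])$ with $B[i]\subseteq V\times V$ is a $k$-limited $\alpha$-bisimulation vector if for all $1\le i\le k$, $(x,y)\in B[i]$ and $\tau\in\Sigma$: $x\overset{\tau}{\longrightarrow}p$ implies there is $y\overset{\tau}{\longrightarrow}q$ with $(p,q)\in(B[i+1])_\alpha^\dagger$, and $y\overset{\tau}{\longrightarrow}q$ implies there is $x\overset{\tau}{\longrightarrow}p$ with $(p,q)\in(B[i+1])_\alpha^\dagger$. *)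

theory Defs
  imports Complex_Main "HOL-Library.FuncSet"
begin

text \<open>
  Supremum in the complete lattice $[0,1]$ of a set \<open>A\<close> of numbers in $[0,1]$.  Inserting \<open>0\<close> does
  not change the supremum of a nonempty \<open>A\<close> and makes the supremum of the empty set \<open>0\<close>
  (the real-valued \<open>Sup\<close> is unspecified there).
\<close>
definition unit_Sup :: "real set \<Rightarrow> real" where
  "unit_Sup A = Sup (insert 0 A)"

text \<open>Only the values of \<open>T\<close> on $[0,1] \times [0,1]$ matter.\<close>
definition left_continuous_tnorm :: "(real \<Rightarrow> real \<Rightarrow> real) \<Rightarrow> bool" where
  "left_continuous_tnorm T \<longleftrightarrow>
     (\<forall>a\<in>{0..1}. \<forall>b\<in>{0..1}. T a b \<in> {0..1}) \<and>
     (\<forall>a\<in>{0..1}. \<forall>b\<in>{0..1}. T a b = T b a) \<and>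
     (\<forall>a\<in>{0..1}. \<forall>b\<in>{0..1}. \<forall>c\<in>{0..1}. T (T a b) c = T a (T b c)) \<and>
     (\<forall>a\<in>{0..1}. \<forall>a'\<in>{0..1}. \<forall>b\<in>{0..1}. \<forall>b'\<in>{0..1}.
        a \<le> a' \<longrightarrow> b \<le> b' \<longrightarrow> T a b \<le> T a' b') \<and>
     (\<forall>a\<in>{0..1}. T a 1 = a) \<and>
     (\<forall>r\<in>{0..1}. \<forall>A\<subseteq>{0..1}. T r (unit_Sup A) = unit_Sup (T r ` A))"

definition residuum :: "(real \<Rightarrow> real \<Rightarrow> real) \<Rightarrow> real \<Rightarrow> real \<Rightarrow> real" where
  "residuum T t r = unit_Sup {s \<in> {0..1}. T s t \<le> r}"

text \<open>Fuzzy subsets of \<open>V\<close>; as maps on \<open>V\<close> they are \<open>undefined\<close> outside \<open>V\<close>.\<close>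
definition fuzzy_subsets :: "'v set \<Rightarrow> ('v \<Rightarrow> real) set" where
  "fuzzy_subsets V = V \<rightarrow>\<^sub>E {0..1}"

definition mass :: "('v \<Rightarrow> real) \<Rightarrow> 'v set \<Rightarrow> real" where
  "mass p X = unit_Sup (p ` X)"

record ('v, 'l) nfts =
  states :: "'v set"
  labels :: "'l set"
  trans_rel :: "('v \<times> 'l \<times> ('v \<Rightarrow> real)) set"

definition is_nfts :: "('v, 'l) nfts \<Rightarrow> bool" where
  "is_nfts S \<longleftrightarrow> finite (states S) \<and> states S \<noteq> {} \<and>
     trans_rel S \<subseteq> states S \<times> labels S \<times> fuzzy_subsets (states S)"

definition delta :: "('v, 'l) nfts \<Rightarrow> 'v \<Rightarrow> 'l \<Rightarrow> ('v \<Rightarrow> real) set" where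
  "delta S u \<tau> = {p. (u, \<tau>, p) \<in> trans_rel S}"

definition finite_nfts :: "('v, 'l) nfts \<Rightarrow> bool" where
  "finite_nfts S \<longleftrightarrow> is_nfts S \<and> finite (states S) \<and> finite (labels S) \<and>
     (\<forall>u\<in>states S. \<forall>\<tau>\<in>labels S. finite (delta S u \<tau>))"

text \<open>
  The degree $\widetilde{S}(p,q,R)$; \<open>R `` {u}\<close> and \<open>R\<inverse> `` {u}\<close> are the sets of successors and
  predecessors of \<open>u\<close> under \<open>R\<close>.
\<close>
definition lift_degree ::
  "(real \<Rightarrow> real \<Rightarrow> real) \<Rightarrow> 'v set \<Rightarrow> ('v \<Rightarrow> real) \<Rightarrow> ('v \<Rightarrow> real) \<Rightarrow> ('v \<times> 'v) set \<Rightarrow> real" where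
  "lift_degree T V p q R =
     (INF u\<in>V. min (residuum T (p u) (mass q (R `` {u}))) (residuum T (q u) (mass p (R\<inverse> `` {u}))))"

definition lift_rel ::
  "(real \<Rightarrow> real \<Rightarrow> real) \<Rightarrow> 'v set \<Rightarrow> real \<Rightarrow> ('v \<times> 'v) set \<Rightarrow> (('v \<Rightarrow> real) \<times> ('v \<Rightarrow> real)) set" where
  "lift_rel T V \<alpha> R =
     {(p, q) \<in> fuzzy_subsets V \<times> fuzzy_subsets V. lift_degree T V p q R \<ge> \<alpha>}"

text \<open>
  The back-and-forth condition shared by the definitions below: every transition of \<open>x\<close> is matched
  by an equally labelled one of \<open>y\<close>, and vice versa, up to the lifting of \<open>R\<close> at level \<open>\<alpha>\<close>.
\<close>
definition transfer ::
  "(real \<Rightarrow> real \<Rightarrow> real) \<Rightarrow> ('v, 'l) nfts \<Rightarrow> real \<Rightarrow> ('v \<times> 'v) set \<Rightarrow> 'v \<Rightarrow> 'v \<Rightarrow> bool" where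
  "transfer T S \<alpha> R x y \<longleftrightarrow>
     (\<forall>\<tau>\<in>labels S.
        (\<forall>p\<in>delta S x \<tau>. \<exists>q\<in>delta S y \<tau>. (p, q) \<in> lift_rel T (states S) \<alpha> R) \<and>
        (\<forall>q\<in>delta S y \<tau>. \<exists>p\<in>delta S x \<tau>. (p, q) \<in> lift_rel T (states S) \<alpha> R))"

primrec lim_bisim ::
  "(real \<Rightarrow> real \<Rightarrow> real) \<Rightarrow> ('v, 'l) nfts \<Rightarrow> real \<Rightarrow> nat \<Rightarrow> ('v \<times> 'v) set" where
  "lim_bisim T S \<alpha> 0 = states S \<times> states S"
| "lim_bisim T S \<alpha> (Suc i) =
     {(x, y) \<in> states S \<times> states S. transfer T S \<alpha> (lim_bisim T S \<alpha> i) x y}"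

primrec reach :: "('v, 'l) nfts \<Rightarrow> 'v \<Rightarrow> nat \<Rightarrow> 'v set" where
  "reach S u 0 = {u}"
| "reach S u (Suc i) =
     {y \<in> states S. \<exists>x\<in>reach S u i. \<exists>\<tau>\<in>labels S. \<exists>p\<in>delta S x \<tau>. p y > 0}"

text \<open>
  A $(k+1)$-vector of relations is represented by a function on \<open>nat\<close>, of which only the values at
  the indices \<open>1, \<dots>, k + 1\<close> are relevant.
\<close>
definition lim_bisim_vector ::
  "(real \<Rightarrow> real \<Rightarrow> real) \<Rightarrow> ('v, 'l) nfts \<Rightarrow> real \<Rightarrow> nat \<Rightarrow> (nat \<Rightarrow> ('v \<times> 'v) set) \<Rightarrow> bool" where
  "lim_bisim_vector T S \<alpha> k B \<longleftrightarrow>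
     (\<forall>i\<in>{1..k + 1}. B i \<subseteq> states S \<times> states S) \<and>
     (\<forall>i\<in>{1..k}. \<forall>(x, y)\<in>B i. transfer T S \<alpha> (B (i + 1)) x y)"

definition reach_vector :: "('v, 'l) nfts \<Rightarrow> 'v \<Rightarrow> 'v \<Rightarrow> nat \<Rightarrow> ('v \<times> 'v) set" where
  "reach_vector S u v i = reach S u (i - 1) \<times> reach S v (i - 1)"

text \<open>Defined by downward recursion on the index, with dummy value \<open>{}\<close> outside \<open>1, \<dots>, k + 1\<close>.\<close>
function H_vector ::
  "(real \<Rightarrow> real \<Rightarrow> real) \<Rightarrow> ('v, 'l) nfts \<Rightarrow> real \<Rightarrow> nat \<Rightarrow> 'v \<Rightarrow> 'v \<Rightarrow> nat \<Rightarrow> ('v \<times> 'v) set" where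
  "H_vector T S \<alpha> k u v i =
     (if i = k + 1 then reach S u k \<times> reach S v k
      else if 1 \<le> i \<and> i \<le> k then
        {(x, y) \<in> reach S u (i - 1) \<times> reach S v (i - 1).
           transfer T S \<alpha> (H_vector T S \<alpha> k u v (i + 1)) x y}
      else {})"
  by pat_completeness auto
termination
  by (relation "measure (\<lambda>(T, S, \<alpha>, k, u, v, i). k + 1 - i)") auto

declare H_vector.simps [simp del]

end

theory Submission
  imports Defs
begin

text \<open>
  The vector \<^term>\<open>H_vector T S \<alpha> k u v\<close> is limited bisimilarity, localised to what is reachable: its
  entry at index \<open>j + 1\<close> is the \<open>(k - j)\<close>-limited bisimilarity restricted to
  \<^term>\<open>reach S u j \<times> reach S v j\<close> (lemma \<open>H_vector_eq_lim_bisim\<close>).  Granting this, the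
  equivalence is the case \<open>j = 0\<close>, where the reachable sets are \<open>{u}\<close> and \<open>{v}\<close>, and the other
  two claims can be read off the definition.

  The localisation goes by induction along the recursion, and it works because the lifting of a
  relation \<open>R\<close> to a pair \<open>(p, q)\<close> sees \<open>R\<close> only on the supports of \<open>p\<close> and \<open>q\<close>
  (lemma \<open>lift_degree_restrict\<close>): a state \<open>w\<close> with \<open>p w = 0\<close> contributes the degree
  \<open>0 \<rightarrow> r = 1\<close> whatever \<open>r\<close> is, and states where \<open>q\<close> vanishes do not affect a supremum of values
  of \<open>q\<close>.  The distributions that leave a state of \<^term>\<open>reach S u j\<close> have, by
  construction, their support in \<^term>\<open>reach S u (Suc j)\<close>.
\<close>

section \<open>Supports and the lifting of relations\<close>

lemma mass_nonneg:
  assumes "p \<in> fuzzy_subsets V" "X \<subseteq> V"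
  shows "0 \<le> mass p X"
proof -
  have "p w \<in> {0..1}" if "w \<in> X" for w
    using assms that unfolding fuzzy_subsets_def by (blast dest: PiE_mem)
  then have "insert 0 (p ` X) \<subseteq> {0..1}"
    by auto
  then have "bdd_above (insert 0 (p ` X))"
    by (rule bdd_above_mono[OF bdd_above_Icc])
  then show ?thesis
    unfolding mass_def unit_Sup_def by (intro cSup_upper) auto
qed

text \<open>The supremum in \<^const>\<open>mass\<close> already includes \<open>0\<close>, so dropping zero values leaves even the set
  whose supremum is taken unchanged.\<close>

lemma mass_restrict_support:
  assumes "\<And>w. w \<in> X - Y \<Longrightarrow> p w = 0"
  shows "mass p (X \<inter> Y) = mass p X"
proof -
  have "p w \<in> insert 0 (p ` (X \<inter> Y))" if "w \<in> X" for w
    using assms[of w] that by (cases "w \<in> Y") auto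
  then have "insert 0 (p ` (X \<inter> Y)) = insert 0 (p ` X)"
    by blast
  then show ?thesis
    by (simp add: mass_def unit_Sup_def)
qed

lemma tnorm_right_zero:
  assumes "left_continuous_tnorm T" "s \<in> {0..1}"
  shows "T s 0 = 0"
proof -
  have closed: "\<forall>a\<in>{0..1}. \<forall>b\<in>{0..1}. T a b \<in> {0..1}"
    and comm: "\<forall>a\<in>{0..1}. \<forall>b\<in>{0..1}. T a b = T b a"
    and mono: "\<forall>a\<in>{0..1}. \<forall>a'\<in>{0..1}. \<forall>b\<in>{0..1}. \<forall>b'\<in>{0..1}.
      a \<le> a' \<longrightarrow> b \<le> b' \<longrightarrow> T a b \<le> T a' b'"
    and unit: "\<forall>a\<in>{0..1}. T a 1 = a"
    using assms(1) unfolding left_continuous_tnorm_def by - (elim conjE, assumption)+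
  have in01: "(0::real) \<in> {0..1}" "(1::real) \<in> {0..1}"
    by auto
  have "T s 0 \<le> T 1 0"
    using mono[rule_format, OF assms(2) in01(2) in01(1) in01(1)] assms(2) by simp
  also have "T 1 0 = 0"
    using comm[rule_format, OF in01(2,1)] unit[rule_format, OF in01(1)] by simp
  finally show ?thesis
    using closed[rule_format, OF assms(2) in01(1)] by simp
qed

lemma residuum_zero_cong:
  assumes "left_continuous_tnorm T" "0 \<le> r" "0 \<le> r'"
  shows "residuum T 0 r = residuum T 0 r'"
proof -
  have "{s \<in> {0..1}. T s 0 \<le> r} = {s \<in> {0..1}. T s 0 \<le> r'}"
    using assms by (auto simp: tnorm_right_zero)
  then show ?thesis
    by (simp add: residuum_def)
qed

text \<open>
  One of the two symmetric halves of \<open>lift_degree_restrict\<close>: for \<open>w\<close> outside \<open>X\<close>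
  both sides are residua of \<open>0\<close>, and for \<open>w\<close> in \<open>X\<close> the restriction removes from the successors of
  \<open>w\<close> only states where \<open>q\<close> vanishes.
\<close>

lemma residuum_mass_restrict:
  assumes T: "left_continuous_tnorm T"
    and q: "q \<in> fuzzy_subsets V"
    and R: "R \<subseteq> V \<times> V"
    and p_supp: "\<And>w. w \<in> V - X \<Longrightarrow> p w = 0"
    and q_supp: "\<And>w. w \<in> V - Y \<Longrightarrow> q w = 0"
    and w: "w \<in> V"
  shows "residuum T (p w) (mass q ((R \<inter> X \<times> Y) `` {w})) = residuum T (p w) (mass q (R `` {w}))"
proof (cases "w \<in> X")
  case True
  then have "(R \<inter> X \<times> Y) `` {w} = R `` {w} \<inter> Y"
    by auto
  moreover have "mass q (R `` {w} \<inter> Y) = mass q (R `` {w})"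
    using R by (intro mass_restrict_support q_supp) auto
  ultimately show ?thesis
    by simp
next
  case False
  then have "p w = 0"
    using w p_supp by auto
  moreover have "(R \<inter> X \<times> Y) `` {w} \<subseteq> V" "R `` {w} \<subseteq> V"
    using R by blast+
  ultimately show ?thesis
    using residuum_zero_cong[OF T mass_nonneg[OF q] mass_nonneg[OF q]] by metis
qed

lemma lift_degree_restrict:
  assumes T: "left_continuous_tnorm T"
    and p: "p \<in> fuzzy_subsets V"
    and q: "q \<in> fuzzy_subsets V"
    and R: "R \<subseteq> V \<times> V"
    and p_supp: "\<And>w. w \<in> V - X \<Longrightarrow> p w = 0"
    and q_supp: "\<And>w. w \<in> V - Y \<Longrightarrow> q w = 0"
  shows "lift_degree T V p q (R \<inter> X \<times> Y) = lift_degree T V p q R"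
proof -
  have converse: "(R \<inter> X \<times> Y)\<inverse> = R\<inverse> \<inter> Y \<times> X" "R\<inverse> \<subseteq> V \<times> V"
    using R by auto
  have "residuum T (p w) (mass q ((R \<inter> X \<times> Y) `` {w})) = residuum T (p w) (mass q (R `` {w}))"
    if "w \<in> V" for w
    using T q R p_supp q_supp that by (rule residuum_mass_restrict)
  moreover have "residuum T (q w) (mass p ((R\<inverse> \<inter> Y \<times> X) `` {w})) =
      residuum T (q w) (mass p (R\<inverse> `` {w}))" if "w \<in> V" for w
    using T p converse(2) q_supp p_supp that by (rule residuum_mass_restrict)
  ultimately show ?thesis
    unfolding lift_degree_def converse(1) by simp
qed

lemma transfer_restrict:
  assumes T: "left_continuous_tnorm T"
    and R: "R \<subseteq> states S \<times> states S"
    and x_supp: "\<And>\<tau> p w. \<tau> \<in> labels S \<Longrightarrow> p \<in> delta S x \<tau> \<Longrightarrow> w \<in> states S - X \<Longrightarrow> p w = 0"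
    and y_supp: "\<And>\<tau> q w. \<tau> \<in> labels S \<Longrightarrow> q \<in> delta S y \<tau> \<Longrightarrow> w \<in> states S - Y \<Longrightarrow> q w = 0"
  shows "transfer T S \<alpha> (R \<inter> X \<times> Y) x y \<longleftrightarrow> transfer T S \<alpha> R x y"
proof -
  have "(p, q) \<in> lift_rel T (states S) \<alpha> (R \<inter> X \<times> Y) \<longleftrightarrow> (p, q) \<in> lift_rel T (states S) \<alpha> R"
    if "\<tau> \<in> labels S" "p \<in> delta S x \<tau>" "q \<in> delta S y \<tau>" for \<tau> p q
  proof -
    have "lift_degree T (states S) p q (R \<inter> X \<times> Y) = lift_degree T (states S) p q R"
      if "p \<in> fuzzy_subsets (states S)" "q \<in> fuzzy_subsets (states S)"
      using T that R x_supp[OF \<open>\<tau> \<in> labels S\<close> \<open>p \<in> delta S x \<tau>\<close>]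
        y_supp[OF \<open>\<tau> \<in> labels S\<close> \<open>q \<in> delta S y \<tau>\<close>]
      by (rule lift_degree_restrict)
    then show ?thesis
      unfolding lift_rel_def by (simp cong: conj_cong)
  qed
  then show ?thesis
    unfolding transfer_def by (simp cong: ball_cong bex_cong)
qed

section \<open>Reachable states\<close>

lemma reach_subset_states:
  assumes "u \<in> states S"
  shows "reach S u i \<subseteq> states S"
  using assms by (cases i) auto

lemma delta_support_reach:
  assumes S: "is_nfts S"
    and x: "x \<in> reach S u i"
    and p: "\<tau> \<in> labels S" "p \<in> delta S x \<tau>"
    and w: "w \<in> states S - reach S u (Suc i)"
  shows "p w = 0"
proof -
  have "p \<in> fuzzy_subsets (states S)"
    using S p(2) by (auto simp: is_nfts_def delta_def)
  then have "0 \<le> p w"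
    using w by (simp add: fuzzy_subsets_def PiE_iff)
  moreover have "\<not> 0 < p w"
    using w x p unfolding reach.simps by blast
  ultimately show ?thesis
    by simp
qed

section \<open>The vector as localised limited bisimilarity\<close>

lemma lim_bisim_subset: "lim_bisim T S \<alpha> i \<subseteq> states S \<times> states S"
  by (cases i) auto

lemma H_vector_last: "H_vector T S \<alpha> k u v (k + 1) = reach S u k \<times> reach S v k"
  by (subst H_vector.simps) simp

lemma H_vector_step:
  assumes "j < k"
  shows "H_vector T S \<alpha> k u v (Suc j) =
    {(x, y) \<in> reach S u j \<times> reach S v j. transfer T S \<alpha> (H_vector T S \<alpha> k u v (Suc (Suc j))) x y}"
  using assms by (subst H_vector.simps) simp

text \<open>
  The induction is on the number \<open>d\<close> of steps that remain, since the vector is computed from its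
  last entry downwards.  In the step the restriction of bisimilarity to the reachable pairs can be
  lifted by \<open>transfer_restrict\<close>, because all transitions concerned lead into those pairs.
\<close>

lemma H_vector_eq_lim_bisim:
  assumes T: "left_continuous_tnorm T"
    and S: "is_nfts S"
    and uv: "u \<in> states S" "v \<in> states S"
    and "j + d = k"
  shows "H_vector T S \<alpha> k u v (Suc j) = lim_bisim T S \<alpha> d \<inter> reach S u j \<times> reach S v j"
  using \<open>j + d = k\<close>
proof (induction d arbitrary: j)
  case 0
  have "reach S u k \<times> reach S v k \<subseteq> states S \<times> states S"
    by (intro Sigma_mono reach_subset_states uv)
  then show ?case
    using 0 H_vector_last[of T S \<alpha> k u v] by (simp add: Int_absorb1)
next
  case (Suc d)
  let ?R = "lim_bisim T S \<alpha> d"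
  have "j < k"
    using Suc.prems by simp
  have IH: "H_vector T S \<alpha> k u v (Suc (Suc j)) =
      ?R \<inter> reach S u (Suc j) \<times> reach S v (Suc j)"
    using Suc.prems by (intro Suc.IH) simp
  have "transfer T S \<alpha> (H_vector T S \<alpha> k u v (Suc (Suc j))) x y \<longleftrightarrow> transfer T S \<alpha> ?R x y"
    if "x \<in> reach S u j" "y \<in> reach S v j" for x y
    unfolding IH
    using that by (intro transfer_restrict T lim_bisim_subset) (blast intro: delta_support_reach[OF S])+
  moreover have "reach S u j \<times> reach S v j \<subseteq> states S \<times> states S"
    by (intro Sigma_mono reach_subset_states uv)
  ultimately show ?case
    unfolding H_vector_step[OF \<open>j < k\<close>] lim_bisim.simps by blast
qed

theorem theorem5p1:
  fixes T :: "real \<Rightarrow> real \<Rightarrow> real"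
    and S :: "('v, 'l) nfts"
    and u v :: 'v
    and k :: nat
    and \<alpha> :: real
  assumes "left_continuous_tnorm T"
    and "finite_nfts S"
    and "u \<in> states S"
    and "v \<in> states S"
    and "\<alpha> \<in> {0..1}"
  shows "lim_bisim_vector T S \<alpha> k (H_vector T S \<alpha> k u v) \<and>
         (\<forall>i\<in>{1..k + 1}. H_vector T S \<alpha> k u v i \<subseteq> reach_vector S u v i) \<and>
         ((u, v) \<in> lim_bisim T S \<alpha> k \<longleftrightarrow> H_vector T S \<alpha> k u v 1 = {(u, v)})"
proof (intro conjI)
  let ?H = "H_vector T S \<alpha> k u v"
  have S: "is_nfts S"
    using assms(2) by (simp add: finite_nfts_def)
  have "?H i \<subseteq> reach_vector S u v i" for i
    by (subst H_vector.simps) (auto simp: reach_vector_def)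
  then show contained: "\<forall>i\<in>{1..k + 1}. ?H i \<subseteq> reach_vector S u v i"
    by blast
  have "?H i \<subseteq> states S \<times> states S" if "i \<in> {1..k + 1}" for i
    using contained that assms(3,4)[THEN reach_subset_states] unfolding reach_vector_def by blast
  moreover have "transfer T S \<alpha> (?H (i + 1)) x y" if "i \<in> {1..k}" "(x, y) \<in> ?H i" for i x y
    using that H_vector_step[of "i - 1" k T S \<alpha> u v] by (cases i) auto
  ultimately show "lim_bisim_vector T S \<alpha> k ?H"
    unfolding lim_bisim_vector_def by blast
  have "?H 1 = lim_bisim T S \<alpha> k \<inter> {(u, v)}"
    using H_vector_eq_lim_bisim[OF assms(1) S assms(3,4), of 0 k k] by simp
  then show "(u, v) \<in> lim_bisim T S \<alpha> k \<longleftrightarrow> ?H 1 = {(u, v)}"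
    by auto
qed

end
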